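(* Let $k$ and $\ell$ be positive integers with $1\leq \ell\leq \sqrt{k}/4$ and let $G$ be a graph on $n\geq k$ vertices. Then the number of $k$-vertex subsets $A\subseteq V(G)$ such that the induced subgraph $G[A]$ is a forest with exactly $\ell$ edges is at most \[50\cdot \ell^{-1/2}\cdot \frac{n^k}{k!}.\]
   Context: Graphs are finite and simple. *)

theory Defs
  imports Complex_Main
begin

record 'a ugraph =
  verts :: "'a set"
  edges :: "'a set set"

definition simple_graph :: "'a ugraph \<Rightarrow> bool" where
  "simple_graph G \<longleftrightarrow> finite (verts G) \<and> (\<forall>e\<in>edges G. e \<subseteq> verts G \<and> card e = 2)"

definition induced_subgraph :: "'a ugraph \<Rightarrow> 'a set \<Rightarrow> 'a ugraph" where
  "induced_subgraph G A = \<lparr>verts = A, edges = {e \<in> edges G. e \<subseteq> A}\<rparr>"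

text \<open>A cycle is given by the list of its vertices in cyclic order, without repeating the first one.\<close>

definition is_cycle :: "'a ugraph \<Rightarrow> 'a list \<Rightarrow> bool" where
  "is_cycle G c \<longleftrightarrow> length c \<ge> 3 \<and> distinct c \<and> set c \<subseteq> verts G \<and>
     (\<forall>i<length c. {c ! i, c ! (Suc i mod length c)} \<in> edges G)"

definition forest :: "'a ugraph \<Rightarrow> bool" where
  "forest G \<longleftrightarrow> (\<nexists>c. is_cycle G c)"

end

theory Submission
  imports Defs
begin

text \<open>
  Acyclicity enters only through the fact that a forest with \<open>l \<ge> 1\<close> edges has more than \<open>l\<close>
  non-isolated vertices. Suppose a set \<open>S\<close> of \<open>s\<close> vertices has at most \<open>4l\<close> non-isolated vertices.
  A LYM-type inequality inside the set of these vertices, together with the \<open>1/\<sigma>\<close> bound for the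
  largest hypergeometric probability, shows that a random \<open>k\<close>-subset of \<open>S\<close> is good with
  probability at most \<open>(5 / sqrt l) * sqrt (k / (s + 1 - k))\<close>.

  Now reveal a random ordering of the vertices and stop at the last time \<open>s\<close> at which the first \<open>s\<close>
  vertices have at most \<open>t\<close> non-isolated ones, where \<open>t\<close> is uniform in \<open>[2l, 4l)\<close>; the first \<open>k\<close>
  vertices are then a uniform \<open>k\<close>-subset of the first \<open>s\<close>. Since each non-isolated vertex becomes
  isolated by at most two single deletions, the stopping time equals \<open>s\<close> with probability at most
  \<open>4 / (s + 1)\<close>. Summing over \<open>k \<le> s < 2k\<close>, and adding the case in which the process reaches
  \<open>2k\<close>, gives the constant 45. If \<open>n < 2k\<close>, then already \<open>n choose k\<close> is much smaller than
  \<open>n ^ k / k!\<close>.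
\<close>

section \<open>Edges and vertices of acyclic graphs\<close>

text \<open>Induction on the number of edges: the first vertex of a longest path is a leaf, so
  deleting its edge costs one edge and at least one vertex. A single edge has two vertices, which
  makes the inequality strict.\<close>

lemma acyclic_card_edges:
  fixes F :: "'a set set"
  assumes "finite F" "\<And>e. e \<in> F \<Longrightarrow> card e = 2" "F \<noteq> {}"
    and "\<nexists>c. length c \<ge> 3 \<and> distinct c \<and>
             (\<forall>i<length c. {c ! i, c ! (Suc i mod length c)} \<in> F)"
  shows "card F < card (\<Union>F)"
  using assms
proof (induction "card F" arbitrary: F rule: less_induct)
  case less
  have fin_e: "finite e" if "e \<in> F" for e
    using less.prems(2)[OF that] by (intro card_ge_0_finite) simp
  have fin: "finite (\<Union>F)" using less.prems(1) fin_e by blast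
  define path where "path p \<longleftrightarrow> distinct p \<and> length p \<ge> 2 \<and> set p \<subseteq> \<Union>F \<and>
    (\<forall>i. Suc i < length p \<longrightarrow> {p ! i, p ! Suc i} \<in> F)" for p
  obtain e where e: "e \<in> F" using less.prems(3) by blast
  then obtain a b where ab: "e = {a, b}" "a \<noteq> b"
    using less.prems(2) card_2_iff by metis
  have "path [a, b]" using ab e by (auto simp: path_def less_Suc_eq)
  moreover have "length p \<le> card (\<Union>F)" if "path p" for p
    using that fin card_mono[of "\<Union>F" "set p"] by (auto simp: path_def distinct_card)
  ultimately obtain p where p: "path p" and longest: "\<And>q. path q \<Longrightarrow> length q \<le> length p"
    using ex_has_greatest_nat[of path "[a, b]" length "Suc (card (\<Union>F))"] le_imp_less_Suc
    by blast
  define x where "x = p ! 0"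
  define y where "y = p ! 1"
  have len: "length p \<ge> 2" and dist: "distinct p" and setp: "set p \<subseteq> \<Union>F"
    and step: "\<And>i. Suc i < length p \<Longrightarrow> {p ! i, p ! Suc i} \<in> F"
    using p by (auto simp: path_def)
  have xy: "{x, y} \<in> F" using step[of 0] len by (simp add: x_def y_def)
  \<comment> \<open>A second neighbour \<open>z\<close> of \<open>x\<close> would extend the longest
    path if it is off \<open>p\<close>; otherwise it would close the initial segment of
    \<open>p\<close> up to \<open>z\<close> into a cycle.\<close>
  have leaf: "f = {x, y}" if f: "f \<in> F" "x \<in> f" for f
  proof (rule ccontr)
    assume neq: "f \<noteq> {x, y}"
    obtain z where z: "f = {x, z}" "z \<noteq> x"
      using less.prems(2)[OF f(1)] f(2) by (metis card_2_iff doubleton_eq_iff insertE singletonD)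
    have zy: "z \<noteq> y" using neq z by auto
    show False
    proof (cases "z \<in> set p")
      case False
      have "path (z # p)"
        using False dist len setp f z step
        by (auto simp: path_def nth_Cons x_def insert_commute split: nat.split)
      then show False using longest by fastforce
    next
      case True
      then obtain j where j: "j < length p" "p ! j = z" by (auto simp: in_set_conv_nth)
      have "j \<noteq> 0" "j \<noteq> 1" using j z zy unfolding x_def y_def by metis+
      then have j2: "j \<ge> 2" by simp
      define c where "c = take (Suc j) p"
      have lc: "length c = Suc j" using j by (simp add: c_def)
      have "{c ! i, c ! (Suc i mod length c)} \<in> F" if "i < length c" for i
      proof (cases "i = j")
        case True
        then show ?thesis using f z j lc by (simp add: c_def x_def insert_commute)
      next
        case False
        then show ?thesis using that step[of i] j lc by (simp add: c_def)
      qed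
      moreover have "distinct c" using dist by (simp add: c_def)
      ultimately show False using less.prems(4) lc j2 by (metis Suc_le_mono numeral_2_eq_2 numeral_3_eq_3)
    qed
  qed
  have neq: "x \<noteq> y" using less.prems(2)[OF xy] by auto
  define F' where "F' = F - {{x, y}}"
  have cF: "card F = Suc (card F')"
    unfolding F'_def using less.prems(1) xy by (metis card_Suc_Diff1)
  have sub: "\<Union>F' \<subseteq> \<Union>F - {x}" using leaf by (auto simp: F'_def)
  have le: "card (\<Union>F') \<le> card (\<Union>F) - 1"
  proof -
    have "x \<in> \<Union>F" using xy by blast
    then have "card (\<Union>F - {x}) = card (\<Union>F) - 1" using fin by simp
    then show ?thesis using card_mono[OF _ sub] fin by simp
  qed
  show ?case
  proof (cases "F' = {}")
    case True
    then have "F = {{x, y}}" using xy by (auto simp: F'_def)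
    then show ?thesis using neq by simp
  next
    case False
    have "card F' < card (\<Union>F')"
      by (rule less.hyps) (use less.prems cF False in \<open>auto simp: F'_def\<close>)
    then show ?thesis using le cF by linarith
  qed
qed

section \<open>The maximum of the hypergeometric distribution\<close>

lemma prod4_ge:
  fixes a b c d :: real
  assumes "0 \<le> a" "a \<le> 1" "0 \<le> b" "b \<le> 1" "0 \<le> c" "c \<le> 1" "0 \<le> d" "d \<le> 1"
  shows "1 - (a + b + c + d) \<le> ((1 - a) * (1 - b)) * ((1 - c) * (1 - d))"
proof -
  have *: "1 - (x + y) \<le> (1 - x) * (1 - y)" if "0 \<le> x" "0 \<le> y" for x y :: real
    using that by (simp add: algebra_simps)
  have **: "0 \<le> (1 - x) * (1 - y)" "(1 - x) * (1 - y) \<le> 1"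
    if "0 \<le> x" "0 \<le> y" "x \<le> 1" "y \<le> 1" for x y :: real
    using that by (auto intro!: mult_le_one)
  define u where "u = 1 - (1 - a) * (1 - b)"
  define v where "v = 1 - (1 - c) * (1 - d)"
  have "u \<le> a + b" "v \<le> c + d" "0 \<le> u" "0 \<le> v"
    using *[of a b] *[of c d] **[of a b] **[of c d] assms by (auto simp: u_def v_def)
  then show ?thesis using *[of u v] by (simp add: u_def v_def)
qed


lemma binomial_step: "Suc i * (n choose Suc i) = (n - i) * (n choose i)"
  by (simp add: binomial_absorption binomial_absorb_comp del: mult_Suc)

text \<open>The ratio of consecutive hypergeometric weights, cross-multiplied to avoid denominators;
  it comes from absorption in both binomial coefficients.\<close>

lemma hypergeometric_step:
  assumes "i < k"
  shows "((w choose Suc i) * (r choose (k - Suc i))) * (Suc i * (r - (k - Suc i))) =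
         ((w choose i) * (r choose (k - i))) * ((w - i) * (k - i))"
proof -
  have ki: "k - i = Suc (k - Suc i)" using assms by simp
  have "(k - i) * (r choose (k - i)) = (r - (k - Suc i)) * (r choose (k - Suc i))"
    unfolding ki by (rule binomial_step)
  then show ?thesis using binomial_step[of i w] by (metis mult.assoc mult.commute)
qed

text \<open>
  Up to a factor, \<open>S ^ 3 / (K * (S - K) * W * (S - W))\<close> is the inverse of the variance \<open>\<sigma>\<^sup>2\<close>. The ratios
  of consecutive terms below the mode show that about \<open>\<sigma>\<close> terms have the same order as the largest.
\<close>

lemma hypergeometric_mode_bound:
  fixes w r k j :: nat
  defines "S \<equiv> real (w + r) + 2" and "K \<equiv> real k + 1" and "W \<equiv> real w + 1"
  assumes kle: "k \<le> w + r" and jk: "j \<le> k"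
    and mode: "\<And>i. i \<le> k \<Longrightarrow> (w choose i) * (r choose (k - i)) \<le> (w choose j) * (r choose (k - j))"
  shows "real ((w choose j) * (r choose (k - j))) \<le>
    2 * sqrt (S ^ 3 / (K * (S - K) * W * (S - W))) * real ((w + r) choose k)"
proof -
  define f where "f i = real ((w choose i) * (r choose (k - i)))" for i
  have fnn: "f i \<ge> 0" for i by (simp add: f_def)
  have total: "(\<Sum>i\<le>k. f i) = real ((w + r) choose k)"
    by (simp add: f_def vandermonde[of w r k, symmetric])
  have fmax: "f i \<le> f j" if "i \<le> k" for i
    unfolding f_def using mode[OF that] of_nat_le_iff by blast
  have fpos: "f j > 0"
  proof (rule ccontr)
    assume "\<not> f j > 0"
    then have "f i = 0" if "i \<le> k" for i using fmax[OF that] fnn[of i] by linarith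
    then have "(\<Sum>i\<le>k. f i) = 0" by simp
    then show False using total kle by simp
  qed
  have jw: "j \<le> w" and kr: "k - j \<le> r"
    using fpos by (auto simp: f_def zero_less_mult_iff intro: ccontr)
  define D where "D = r - (k - j)"
  have rD: "real r = real D + real k - real j" using kr jk by (simp add: D_def of_nat_diff)
  have step: "f (Suc i) * (real (Suc i) * real (r - (k - Suc i))) = f i * (real (w - i) * real (k - i))"
    if "i < k" for i
    unfolding f_def using hypergeometric_step[OF that, of w r] by (metis of_nat_mult)
  \<comment> \<open>Apart from the added \<open>1\<close> in \<open>a\<close> and \<open>b\<close>,
    these are the four cells of the two-by-two table with margins \<open>w\<close>, \<open>r\<close>
    and \<open>k\<close>. The shifts make \<open>K = a + d\<close>, \<open>W = a + c\<close> and
    \<open>S = a + b + c + d\<close> exact.\<close>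
  define a b c d where "a = real j + 1" and "b = real D + 1"
    and "c = real w - real j" and "d = real k - real j"
  have nn: "a \<ge> 1" "b \<ge> 1" "c \<ge> 0" "d \<ge> 0" using jw jk by (auto simp: a_def b_def c_def d_def)
  \<comment> \<open>The mode is compared with its right neighbour; for \<open>j = k\<close> there is
    none, but then \<open>d = 0\<close>.\<close>
  have up: "c * d \<le> a * b"
  proof (cases "j < k")
    case True
    have "r - (k - Suc j) = Suc D" using True kr by (simp add: D_def)
    then have "f (Suc j) * (a * b) = f j * (c * d)"
      using step[OF True] jw jk by (simp add: a_def b_def c_def d_def of_nat_diff algebra_simps)
    moreover have "f (Suc j) * (a * b) \<le> f j * (a * b)"
      using True nn by (intro mult_right_mono fmax) auto
    ultimately show ?thesis using fpos by simp
  next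
    case False
    then have "d = 0" using jk by (simp add: d_def)
    then show ?thesis using nn by simp
  qed
  have down: "f (j - t) * ((a - real (Suc t)) * (b - real (Suc t))) =
      f (j - Suc t) * ((c + real (Suc t)) * (d + real (Suc t)))" if "t < j" "t \<le> D" for t
  proof -
    have 1: "Suc (j - Suc t) = j - t" using that by simp
    have 2: "r - (k - (j - t)) = D - t" using that jk kr by (simp add: D_def)
    have "f (j - t) * (real (j - t) * real (D - t)) =
        f (j - Suc t) * (real (w - (j - Suc t)) * real (k - (j - Suc t)))"
      using step[of "j - Suc t"] that jk unfolding 1 2 by simp
    moreover have "real (j - t) = a - real (Suc t)" "real (D - t) = b - real (Suc t)"
      "real (w - (j - Suc t)) = c + real (Suc t)" "real (k - (j - Suc t)) = d + real (Suc t)"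
      using that jw jk by (auto simp: a_def b_def c_def d_def of_nat_diff)
    ultimately show ?thesis by simp
  qed
  \<comment> \<open>The mode is compared with its left neighbour; for \<open>j = 0\<close> the
    factor \<open>a - 1\<close> vanishes.\<close>
  have low: "(a - 1) * (b - 1) \<le> (c + 1) * (d + 1)"
  proof (cases "j = 0")
    case False
    have "f j * ((a - 1) * (b - 1)) = f (j - 1) * ((c + 1) * (d + 1))"
      using down[of 0] False by simp
    also have "\<dots> \<le> f j * ((c + 1) * (d + 1))"
      using nn jk by (intro mult_right_mono fmax) auto
    finally show ?thesis using fpos by simp
  qed (use nn in \<open>simp add: a_def\<close>)
  define L where "L = S ^ 3 / (K * (S - K) * W * (S - W))"
  have pos: "K > 0" "S - K > 0" "W > 0" "S - W > 0" "S > 0"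
    using kle by (auto simp: S_def K_def W_def)
  have rec: "1 / a + 1 / b + 1 / (c + 1) + 1 / (d + 1) \<le> L"
  proof -
    have eqs: "K = a + d" "W = a + c" "S = a + b + c + d"
      using rD by (auto simp: a_def b_def c_def d_def K_def W_def S_def)
    have inv: "1 / y \<le> S / x" if "x \<le> y * S" "0 < x" "0 < y" for x y :: real
      using that by (simp add: field_simps)
    \<comment> \<open>After expansion the first two bounds are exactly \<open>up\<close>, and the
      last two are exactly \<open>low\<close>.\<close>
    have "W * K \<le> a * S" "(S - W) * (S - K) \<le> b * S"
      "W * (S - K) \<le> (c + 1) * S" "(S - W) * K \<le> (d + 1) * S"
      using up low unfolding eqs by (simp_all add: algebra_simps)
    then have recs: "1 / a \<le> S / (W * K)" "1 / b \<le> S / ((S - W) * (S - K))"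
      "1 / (c + 1) \<le> S / (W * (S - K))" "1 / (d + 1) \<le> S / ((S - W) * K)"
      by (intro inv; use nn pos in simp)+
    have "S / (W * K) + S / ((S - W) * (S - K)) + S / (W * (S - K)) + S / ((S - W) * K)
        = S * (1 / W + 1 / (S - W)) * (1 / K + 1 / (S - K))"
      by (simp add: algebra_simps)
    also have "1 / W + 1 / (S - W) = S / (W * (S - W))" using pos by (simp add: field_simps)
    also have "1 / K + 1 / (S - K) = S / (K * (S - K))" using pos by (simp add: field_simps)
    also have "S * (S / (W * (S - W))) * (S / (K * (S - K))) = L"
      by (simp add: L_def power3_eq_cube mult_ac)
    finally show ?thesis using recs by linarith
  qed
  have Lpos: "L > 0" using pos by (simp add: L_def)
  \<comment> \<open>By \<open>rec\<close>, \<open>1 / L\<close> lies below both \<open>j + 1\<close>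
    and \<open>D + 1\<close>, and a natural number is at most its square. Hence \<open>t\<close>
    steps down from the mode stay where \<open>down\<close> applies.\<close>
  have small: "t \<le> j \<and> t \<le> D" if t: "real t ^ 2 * L \<le> 1" for t
  proof -
    have *: "t \<le> m" if m: "1 / (real m + 1) < L" for m
    proof (rule ccontr)
      assume "\<not> t \<le> m"
      then have "real m + 1 \<le> real t" by linarith
      moreover have "real t \<le> real t ^ 2" using \<open>\<not> t \<le> m\<close> by (simp add: power2_eq_square)
      ultimately have "real m + 1 \<le> real t ^ 2" by linarith
      then have "L * (real m + 1) \<le> L * real t ^ 2" using Lpos by (intro mult_left_mono) auto
      moreover have "1 < L * (real m + 1)" using m by (simp add: field_simps)
      ultimately have "1 < L * real t ^ 2" by linarith
      then show False using t by (simp add: mult.commute)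
    qed
    have "1 / a > 0" "1 / b > 0" "1 / (c + 1) > 0" "1 / (d + 1) > 0" using nn by auto
    then have "1 / a < L" "1 / b < L" using rec by linarith+
    then show ?thesis using *[of j] *[of D] by (simp add: a_def b_def)
  qed
  have decay: "f j * (1 - real (t * (t + 1)) / 2 * L) \<le> f (j - t)" if "real t ^ 2 * L \<le> 1" for t
    using that
  proof (induction t)
    case (Suc t)
    define u where "u = real (Suc t)"
    have u1: "u \<ge> 1" by (simp add: u_def)
    have uL: "u * L \<le> 1"
    proof -
      have "u * L \<le> u ^ 2 * L" using u1 Lpos by (intro mult_right_mono) (auto simp: power2_eq_square)
      then show ?thesis using Suc.prems by (simp add: u_def)
    qed
    have sm: "t < j" "t < D" using small[OF Suc.prems] by auto
    have "real t ^ 2 * L \<le> real (Suc t) ^ 2 * L"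
      using Lpos by (intro mult_right_mono power_mono) auto
    then have IH: "f j * (1 - real (t * (t + 1)) / 2 * L) \<le> f (j - t)"
      using Suc by linarith
    have ua: "u \<le> a" "u \<le> b" using sm by (auto simp: u_def a_def b_def)
    have "1 - u * L \<le> 1 - (u / a + u / b + u / (c + u) + u / (d + u))"
    proof -
      have "u / (c + u) \<le> u / (c + 1)" "u / (d + u) \<le> u / (d + 1)"
        using u1 nn by (auto intro!: divide_left_mono mult_pos_pos)
      moreover have "u * (1 / a + 1 / b + 1 / (c + 1) + 1 / (d + 1)) \<le> u * L"
        using rec u1 by (intro mult_left_mono) auto
      ultimately show ?thesis by (simp add: algebra_simps)
    qed
    \<comment> \<open>The product of the four factors is the ratio of consecutive terms times
      \<open>(c * d) / (a * b)\<close>, and \<open>up\<close> bounds the latter by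
      \<open>1\<close>.\<close>
    also have "\<dots> \<le> ((1 - u / a) * (1 - u / b)) * ((1 - u / (c + u)) * (1 - u / (d + u)))"
      using u1 ua nn by (intro prod4_ge) auto
    also have "\<dots> = (a - u) * (b - u) * (c * d) / (a * b * ((c + u) * (d + u)))"
      using u1 nn by (simp add: field_simps)
    also have "\<dots> \<le> (a - u) * (b - u) * (a * b) / (a * b * ((c + u) * (d + u)))"
      using u1 ua nn up by (intro divide_right_mono mult_left_mono) auto
    also have "\<dots> = (a - u) * (b - u) / ((c + u) * (d + u))" using nn by simp
    finally have ratio: "1 - u * L \<le> (a - u) * (b - u) / ((c + u) * (d + u))" .
    have "f j * (1 - real (Suc t * (Suc t + 1)) / 2 * L) \<le>
        f j * ((1 - real (t * (t + 1)) / 2 * L) * (1 - u * L))"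
    proof (intro mult_left_mono)
      have "0 \<le> (real (t * (t + 1)) / 2 * L) * (u * L)" using Lpos u1 by simp
      moreover have "real (Suc t * (Suc t + 1)) / 2 = real (t * (t + 1)) / 2 + u"
        by (simp add: u_def field_simps)
      ultimately show "1 - real (Suc t * (Suc t + 1)) / 2 * L \<le> (1 - real (t * (t + 1)) / 2 * L) * (1 - u * L)"
        by (simp add: algebra_simps)
    qed (use fpos in simp)
    also have "\<dots> \<le> f (j - t) * (1 - u * L)"
      using mult_right_mono[OF IH, of "1 - u * L"] uL by (simp add: mult.assoc)
    also have "\<dots> \<le> f (j - t) * ((a - u) * (b - u) / ((c + u) * (d + u)))"
      using ratio fnn by (intro mult_left_mono) auto
    also have "\<dots> = f (j - Suc t)"
    proof -
      have "f (j - t) * ((a - u) * (b - u)) = f (j - Suc t) * ((c + u) * (d + u))"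
        using down[of t] sm unfolding u_def by simp
      moreover have "(c + u) * (d + u) \<noteq> 0" using u1 nn by simp
      ultimately show ?thesis by simp
    qed
    finally show ?case .
  qed simp
  \<comment> \<open>If \<open>L > 1\<close>, the factor \<open>2 * sqrt L\<close> exceeds
    \<open>1\<close> and it suffices that one term is at most the whole sum.\<close>
  show ?thesis
  proof (cases "L \<le> 1")
    case False
    have "f j \<le> (\<Sum>i\<le>k. f i)" using jk fnn by (intro member_le_sum) auto
    also have "\<dots> = 1 * (\<Sum>i\<le>k. f i)" by simp
    also have "\<dots> \<le> 2 * sqrt L * (\<Sum>i\<le>k. f i)"
    proof (rule mult_right_mono)
      have "sqrt L \<ge> 1" using False by simp
      then show "1 \<le> 2 * sqrt L" by linarith
    qed (simp add: sum_nonneg fnn)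
    finally show ?thesis unfolding total unfolding f_def L_def .
  next
    case True
    define x where "x = 1 / sqrt L"
    define I where "I = nat \<lfloor>x\<rfloor>"
    have x1: "x \<ge> 1" and xL: "x ^ 2 * L = 1" using True Lpos by (auto simp: x_def power_divide)
    have I: "real I \<le> x" "x \<le> real I + 1" using x1 unfolding I_def by linarith+
    have tL: "real t ^ 2 * L \<le> 1" if "t \<le> I" for t
    proof -
      have "real t ^ 2 * L \<le> x ^ 2 * L"
        using that I Lpos by (intro mult_right_mono power_mono) auto
      then show ?thesis using xL by simp
    qed
    have Ij: "I \<le> j" using small[OF tL] by blast
    \<comment> \<open>The \<open>I + 1\<close> terms from the mode downwards have decay factors with
      sum \<open>(I + 1) * (1 - I * (I + 2) * L / 6)\<close>. This is at least
      \<open>(I + 1) / 2\<close>, since \<open>I * (I + 2) * L\<close> is at most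
      \<open>3 * x ^ 2 * L = 3\<close>.\<close>
    have "f j * (x / 2) \<le> f j * (\<Sum>t\<le>I. 1 - real (t * (t + 1)) / 2 * L)"
    proof (intro mult_left_mono)
      have "(\<Sum>t\<le>n. 1 - real (t * (t + 1)) / 2 * L) = (real n + 1) * (1 - real (n * (n + 2)) / 6 * L)" for n
        by (induction n) (auto simp: field_simps)
      moreover have "real (I * (I + 2)) * L \<le> 3"
      proof -
        have "real (I * (I + 2)) * L \<le> (x * (x + 2)) * L"
          unfolding of_nat_mult using I Lpos by (intro mult_right_mono mult_mono) auto
        also have "\<dots> \<le> 3 * x ^ 2 * L"
          using x1 Lpos by (intro mult_right_mono) (auto simp: power2_eq_square algebra_simps)
        finally show ?thesis using xL by simp
      qed
      ultimately have "(real I + 1) * (1 / 2) \<le> (\<Sum>t\<le>I. 1 - real (t * (t + 1)) / 2 * L)"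
        by (simp only:) (intro mult_left_mono, auto simp: mult.commute)
      moreover have "x / 2 \<le> (real I + 1) * (1 / 2)" using I by simp
      ultimately show "x / 2 \<le> (\<Sum>t\<le>I. 1 - real (t * (t + 1)) / 2 * L)" by (rule order.trans[rotated])
    qed (use fpos in simp)
    also have "\<dots> \<le> (\<Sum>t\<le>I. f (j - t))"
      unfolding sum_distrib_left by (intro sum_mono decay tL) simp
    also have "\<dots> = (\<Sum>i\<in>(\<lambda>t. j - t) ` {..I}. f i)"
      using Ij by (subst sum.reindex) (auto simp: inj_on_def)
    also have "\<dots> \<le> (\<Sum>i\<le>k. f i)" using jk fnn by (intro sum_mono2) auto
    finally have "f j * (x / 2) \<le> real ((w + r) choose k)" by (simp add: total)
    then have "f j \<le> 2 * sqrt L * real ((w + r) choose k)"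
      using Lpos by (simp add: x_def field_simps)
    then show ?thesis unfolding f_def L_def .
  qed
qed

lemma hypergeometric_bound:
  fixes w r k j :: nat
  defines "S \<equiv> real (w + r) + 2" and "K \<equiv> real k + 1" and "W \<equiv> real w + 1"
  assumes kle: "k \<le> w + r" and jk: "j \<le> k"
  shows "real ((w choose j) * (r choose (k - j))) \<le>
    2 * sqrt (S ^ 3 / (K * (S - K) * W * (S - W))) * real ((w + r) choose k)"
proof -
  define f where "f i = (w choose i) * (r choose (k - i))" for i
  obtain m where m: "m \<le> k" "\<And>i. i \<le> k \<Longrightarrow> f i \<le> f m"
    using finite_imageI[of "{..k}" f] Max_in[of "f ` {..k}"] Max_ge[of "f ` {..k}"] by fastforce
  have "real (f m) \<le> 2 * sqrt (S ^ 3 / (K * (S - K) * W * (S - W))) * real ((w + r) choose k)"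
    unfolding f_def S_def K_def W_def
    by (rule hypergeometric_mode_bound[OF kle m(1)]) (use m(2) in \<open>simp add: f_def\<close>)
  then show ?thesis using m(2)[OF jk] by (simp add: f_def del: of_nat_mult)
qed

section \<open>Averages over subsets of fixed size\<close>

definition slice :: "'a set \<Rightarrow> nat \<Rightarrow> 'a set set" where
  "slice V j = {A. A \<subseteq> V \<and> card A = j}"

text \<open>The expectation of \<open>f\<close> at a uniformly random \<open>j\<close>-subset of
  \<open>V\<close>.\<close>

definition slice_avg :: "'a set \<Rightarrow> nat \<Rightarrow> ('a set \<Rightarrow> real) \<Rightarrow> real" where
  "slice_avg V j f = (\<Sum>A\<in>slice V j. f A) / real (card V choose j)"

lemma finite_slice [simp]: "finite V \<Longrightarrow> finite (slice V j)"
  unfolding slice_def by (rule finite_subset[of _ "Pow V"]) auto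

lemma finite_in_slice: "finite V \<Longrightarrow> A \<in> slice V j \<Longrightarrow> finite A"
  by (auto simp: slice_def intro: finite_subset)

lemma card_slice: "finite V \<Longrightarrow> card (slice V j) = card V choose j"
  unfolding slice_def by (rule n_subsets)

lemma slice_self: "finite A \<Longrightarrow> slice A (card A) = {A}"
  by (auto simp: slice_def dest: card_subset_eq)

lemma slice_avg_self: "finite A \<Longrightarrow> slice_avg A (card A) f = f A"
  by (simp add: slice_avg_def slice_self)

lemma slice_avg_mono:
  assumes "\<And>A. A \<in> slice V j \<Longrightarrow> f A \<le> g A"
  shows "slice_avg V j f \<le> slice_avg V j g"
  unfolding slice_avg_def using assms by (intro divide_right_mono sum_mono) auto

lemma slice_avg_cong:
  assumes "\<And>A. A \<in> slice V j \<Longrightarrow> f A = g A"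
  shows "slice_avg V j f = slice_avg V j g"
  unfolding slice_avg_def using assms by (simp cong: sum.cong)

lemma slice_avg_nonneg:
  assumes "\<And>A. A \<in> slice V j \<Longrightarrow> 0 \<le> f A"
  shows "0 \<le> slice_avg V j f"
  unfolding slice_avg_def using assms by (intro divide_nonneg_nonneg sum_nonneg) auto

lemma slice_avg_const:
  assumes "finite V" "j \<le> card V"
  shows "slice_avg V j (\<lambda>_. c) = c"
  using assms by (simp add: slice_avg_def card_slice)

lemma slice_avg_diff: "slice_avg V j (\<lambda>A. f A - g A) = slice_avg V j f - slice_avg V j g"
  by (simp add: slice_avg_def sum_subtractf diff_divide_distrib)

lemma slice_avg_sum: "slice_avg V j (\<lambda>A. \<Sum>i\<in>I. f i A) = (\<Sum>i\<in>I. slice_avg V j (f i))"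
  unfolding slice_avg_def by (subst sum.swap) (simp add: sum_divide_distrib)

lemma slice_avg_cmult: "slice_avg V j (\<lambda>A. c * f A) = c * slice_avg V j f"
  by (simp add: slice_avg_def sum_distrib_left)

text \<open>Deleting a uniform element of a uniform \<open>Suc j\<close>-subset gives a uniform
  \<open>j\<close>-subset: each \<open>A\<close> arises from exactly \<open>card V - j\<close> pairs
  \<open>(S, v)\<close>.\<close>

lemma slice_avg_shadow:
  assumes fin: "finite V" and j: "j < card V"
  shows "slice_avg V j f = slice_avg V (Suc j) (\<lambda>S. (\<Sum>v\<in>S. f (S - {v})) / real (Suc j))"
proof -
  have finS: "finite S" if "S \<in> slice V i" for S i
    using finite_in_slice[OF fin that] .
  have "(\<Sum>S\<in>slice V (Suc j). \<Sum>v\<in>S. f (S - {v})) =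
      (\<Sum>p\<in>Sigma (slice V (Suc j)) (\<lambda>S. S). f (fst p - {snd p}))"
    by (subst sum.Sigma) (use fin finS in \<open>auto simp: case_prod_beta\<close>)
  also have "\<dots> = (\<Sum>p\<in>Sigma (slice V j) (\<lambda>A. V - A). f (fst p))"
  proof (rule sum.reindex_bij_witness[where i = "\<lambda>(A, v). (insert v A, v)" and j = "\<lambda>(S, v). (S - {v}, v)"], goal_cases)
    case (1 a) then show ?case by (auto simp: insert_absorb)
  next
    case (2 a)
    then obtain S v where "a = (S, v)" "S \<in> slice V (Suc j)" "v \<in> S" by auto
    then show ?case using finS[of S "Suc j"] by (auto simp: slice_def)
  next
    case (3 b) then show ?case by auto
  next
    case (4 b)
    then obtain A v where "b = (A, v)" "A \<in> slice V j" "v \<in> V - A" by auto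
    then show ?case using finS[of A j] by (auto simp: slice_def)
  next
    case (5 a) then show ?case by auto
  qed
  also have "\<dots> = (\<Sum>A\<in>slice V j. \<Sum>v\<in>V - A. f A)"
    by (subst sum.Sigma) (use fin in \<open>auto simp: case_prod_beta\<close>)
  also have "\<dots> = (\<Sum>A\<in>slice V j. real (card V - j) * f A)"
  proof (rule sum.cong[OF refl])
    fix A assume A: "A \<in> slice V j"
    then have "card (V - A) = card V - j"
      using finS[OF A] by (auto simp: slice_def card_Diff_subset)
    then show "(\<Sum>v\<in>V - A. f A) = real (card V - j) * f A" by simp
  qed
  finally have eq: "(\<Sum>S\<in>slice V (Suc j). \<Sum>v\<in>S. f (S - {v})) = real (card V - j) * (\<Sum>A\<in>slice V j. f A)"
    by (simp only: sum_distrib_left)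
  have bin: "real (Suc j) * real (card V choose Suc j) = real (card V - j) * real (card V choose j)"
    using binomial_step[of j "card V"] by (metis of_nat_mult)
  have "slice_avg V (Suc j) (\<lambda>S. (\<Sum>v\<in>S. f (S - {v})) / real (Suc j)) =
      real (card V - j) * (\<Sum>A\<in>slice V j. f A) / (real (Suc j) * real (card V choose Suc j))"
    unfolding slice_avg_def by (simp only: sum_divide_distrib[symmetric] eq) simp
  also have "\<dots> = slice_avg V j f"
    unfolding bin slice_avg_def using j by simp
  finally show ?thesis by simp
qed

text \<open>Discarding a uniform vertex first does not bias the \<open>k\<close>-subset drawn
  afterwards, because each \<open>A\<close> avoids exactly \<open>card S - k\<close>
  vertices.\<close>

lemma slice_avg_remove:
  assumes fin: "finite S" and k: "k < card S"
  shows "slice_avg S k f = (\<Sum>v\<in>S. slice_avg (S - {v}) k f) / real (card S)"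
proof -
  have finA: "finite A" if "A \<in> slice S k" for A
    using finite_in_slice[OF fin that] .
  have "(\<Sum>v\<in>S. \<Sum>A\<in>slice (S - {v}) k. f A) = (\<Sum>v\<in>S. \<Sum>A\<in>slice S k. if v \<notin> A then f A else 0)"
  proof (rule sum.cong[OF refl])
    fix v assume "v \<in> S"
    have "slice (S - {v}) k = {A \<in> slice S k. v \<notin> A}" by (auto simp: slice_def)
    then show "(\<Sum>A\<in>slice (S - {v}) k. f A) = (\<Sum>A\<in>slice S k. if v \<notin> A then f A else 0)"
      using fin by (simp only: sum.inter_filter finite_slice)
  qed
  also have "\<dots> = (\<Sum>A\<in>slice S k. \<Sum>v\<in>S. if v \<notin> A then f A else 0)" by (rule sum.swap)
  also have "\<dots> = (\<Sum>A\<in>slice S k. real (card S - k) * f A)"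
  proof (rule sum.cong[OF refl])
    fix A assume A: "A \<in> slice S k"
    then have "card (S - A) = card S - k"
      using finA[OF A] by (auto simp: slice_def card_Diff_subset)
    moreover have "{v \<in> S. v \<notin> A} = S - A" by auto
    ultimately show "(\<Sum>v\<in>S. if v \<notin> A then f A else 0) = real (card S - k) * f A"
      using fin by (simp add: sum.inter_filter[symmetric])
  qed
  finally have eq: "(\<Sum>v\<in>S. \<Sum>A\<in>slice (S - {v}) k. f A) = real (card S - k) * (\<Sum>A\<in>slice S k. f A)"
    by (simp only: sum_distrib_left)
  have "(card S - k) * (card S choose k) = card S * ((card S - 1) choose k)"
    by (rule binomial_absorb_comp)
  then have bin: "real (card S) * real ((card S - 1) choose k) = real (card S - k) * real (card S choose k)"
    by (metis of_nat_mult)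
  have "(\<Sum>v\<in>S. slice_avg (S - {v}) k f) = (\<Sum>v\<in>S. \<Sum>A\<in>slice (S - {v}) k. f A) / real ((card S - 1) choose k)"
    unfolding slice_avg_def sum_divide_distrib using fin by (intro sum.cong) auto
  then have "(\<Sum>v\<in>S. slice_avg (S - {v}) k f) / real (card S) =
      real (card S - k) * (\<Sum>A\<in>slice S k. f A) / (real (card S) * real ((card S - 1) choose k))"
    unfolding eq by (simp add: mult.commute)
  also have "\<dots> = slice_avg S k f" unfolding bin slice_avg_def using k by simp
  finally show ?thesis by simp
qed

text \<open>Once the trace on \<open>W\<close> is fixed, the rest of \<open>A\<close> is an
  arbitrary subset of \<open>S - W\<close> of the missing size. This produces the hypergeometric
  weights; \<open>card W \<le> k\<close> keeps the subtraction \<open>k - j\<close> exact.\<close>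

lemma slice_sum_inter:
  fixes f :: "'a set \<Rightarrow> real"
  assumes fin: "finite S" and W: "W \<subseteq> S" and k: "card W \<le> k"
  shows "(\<Sum>A\<in>slice S k. f (A \<inter> W)) =
         (\<Sum>j\<le>card W. (\<Sum>Q\<in>slice W j. f Q) * real ((card S - card W) choose (k - j)))"
proof -
  have finW: "finite W" using fin W finite_subset by blast
  have "(\<Sum>A\<in>slice S k. f (A \<inter> W)) =
      (\<Sum>p\<in>Sigma (Pow W) (\<lambda>Q. slice (S - W) (k - card Q)). f (fst p))"
  proof (rule sum.reindex_bij_witness[where i = "\<lambda>(Q, R). Q \<union> R" and j = "\<lambda>A. (A \<inter> W, A - W)"], goal_cases)
    case (1 A) then show ?case by auto
  next
    case (2 A)
    then have "finite A" using finite_in_slice[OF fin] by blast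
    moreover have "card A = k" using 2 by (simp add: slice_def)
    ultimately have "card (A - W) = k - card (A \<inter> W)" by (metis card_Diff_subset_Int finite_Int)
    then show ?case using 2 by (auto simp: slice_def)
  next
    case (3 p) then show ?case by (auto simp: slice_def)
  next
    case (4 p)
    then obtain Q R where p: "p = (Q, R)" "Q \<subseteq> W" "R \<subseteq> S - W" "card R = k - card Q"
      by (auto simp: slice_def)
    have "finite Q" "finite R" "Q \<inter> R = {}"
      using p finW finite_subset[of R S] finite_subset[of Q W] fin by auto
    then have "card (Q \<union> R) = card Q + card R" by (rule card_Un_disjoint)
    also have "\<dots> = k" using p card_mono[OF finW p(2)] k by simp
    finally show ?case using p W by (auto simp: slice_def)
  next
    case (5 A) then show ?case by auto
  qed
  also have "\<dots> = (\<Sum>Q\<in>Pow W. f Q * real ((card S - card W) choose (k - card Q)))"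
  proof -
    have "(\<Sum>p\<in>Sigma (Pow W) (\<lambda>Q. slice (S - W) (k - card Q)). f (fst p)) =
        (\<Sum>Q\<in>Pow W. \<Sum>R\<in>slice (S - W) (k - card Q). f Q)"
      by (subst sum.Sigma) (use fin finW in \<open>auto simp: case_prod_beta\<close>)
    then show ?thesis using fin finW W by (simp add: card_slice card_Diff_subset mult.commute)
  qed
  also have "\<dots> = (\<Sum>j\<le>card W. \<Sum>Q\<in>{Q \<in> Pow W. card Q = j}. f Q * real ((card S - card W) choose (k - card Q)))"
    using finW by (intro sum.group[symmetric]) (auto intro: card_mono)
  also have "\<dots> = (\<Sum>j\<le>card W. (\<Sum>Q\<in>slice W j. f Q) * real ((card S - card W) choose (k - j)))"
    unfolding sum_distrib_right by (intro sum.cong) (auto simp: slice_def)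
  finally show ?thesis .
qed

section \<open>Non-isolated vertices of induced subgraphs\<close>

definition induced_edges :: "'a set set \<Rightarrow> 'a set \<Rightarrow> 'a set set" where
  "induced_edges E A = {e \<in> E. e \<subseteq> A}"

definition nonisolated :: "'a set set \<Rightarrow> 'a set \<Rightarrow> 'a set" where
  "nonisolated E A = \<Union>(induced_edges E A)"

lemma finite_induced_edges: "finite A \<Longrightarrow> finite (induced_edges E A)"
  unfolding induced_edges_def by (rule finite_subset[of _ "Pow A"]) auto

lemma induced_edges_mono: "A \<subseteq> B \<Longrightarrow> induced_edges E A \<subseteq> induced_edges E B"
  by (auto simp: induced_edges_def)

lemma nonisolated_mono: "A \<subseteq> B \<Longrightarrow> nonisolated E A \<subseteq> nonisolated E B"
  by (auto simp: nonisolated_def induced_edges_def)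

lemma nonisolated_subset: "nonisolated E A \<subseteq> A"
  by (auto simp: nonisolated_def induced_edges_def)

lemma finite_nonisolated: "finite A \<Longrightarrow> finite (nonisolated E A)"
  using nonisolated_subset finite_subset by metis

lemma induced_edges_Int_nonisolated:
  "A \<subseteq> S \<Longrightarrow> induced_edges E (A \<inter> nonisolated E S) = induced_edges E A"
  by (auto simp: nonisolated_def induced_edges_def)

lemma card_nonisolated_le:
  assumes "\<And>e. e \<in> E \<Longrightarrow> card e = 2"
  shows "card (nonisolated E A) \<le> 2 * card (induced_edges E A)"
proof -
  have "card (nonisolated E A) \<le> (\<Sum>e\<in>induced_edges E A. card e)"
    unfolding nonisolated_def by (rule card_Union_le_sum_card)
  also have "\<dots> = 2 * card (induced_edges E A)"
    using assms by (simp add: induced_edges_def)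
  finally show ?thesis .
qed

text \<open>Deleting \<open>v\<close> isolates \<open>u\<close> only if \<open>v\<close> lies in every edge at \<open>u\<close>, which leaves two choices of \<open>v\<close>.\<close>

lemma sum_card_nonisolated_diff:
  assumes fin: "finite S" and E: "\<And>e. e \<in> E \<Longrightarrow> card e = 2"
  shows "(\<Sum>v\<in>S. card (nonisolated E S - nonisolated E (S - {v}))) \<le> 2 * card (nonisolated E S)"
proof -
  let ?N = "nonisolated E S"
  have finN: "finite ?N" using fin by (rule finite_nonisolated)
  have "(\<Sum>v\<in>S. card (?N - nonisolated E (S - {v}))) =
      (\<Sum>v\<in>S. \<Sum>u\<in>?N. if u \<notin> nonisolated E (S - {v}) then 1 else 0)"
  proof (rule sum.cong[OF refl])
    fix v
    have "?N - nonisolated E (S - {v}) = {u \<in> ?N. u \<notin> nonisolated E (S - {v})}" by auto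
    then show "card (?N - nonisolated E (S - {v})) =
        (\<Sum>u\<in>?N. if u \<notin> nonisolated E (S - {v}) then 1 else 0)"
      using finN by (simp only: card_eq_sum sum.inter_filter)
  qed
  also have "\<dots> = (\<Sum>u\<in>?N. \<Sum>v\<in>S. if u \<notin> nonisolated E (S - {v}) then 1 else 0)"
    by (rule sum.swap)
  also have "\<dots> = (\<Sum>u\<in>?N. card {v \<in> S. u \<notin> nonisolated E (S - {v})})"
    using fin by (simp only: card_eq_sum sum.inter_filter)
  also have "\<dots> \<le> (\<Sum>u\<in>?N. 2)"
  proof (rule sum_mono)
    fix u assume "u \<in> ?N"
    then obtain e where e: "e \<in> E" "e \<subseteq> S" "u \<in> e"
      by (auto simp: nonisolated_def induced_edges_def)
    have "{v \<in> S. u \<notin> nonisolated E (S - {v})} \<subseteq> e"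
      using e by (auto simp: nonisolated_def induced_edges_def)
    moreover have "finite e" using e(2) fin finite_subset by blast
    ultimately show "card {v \<in> S. u \<notin> nonisolated E (S - {v})} \<le> 2"
      using E[OF e(1)] card_mono by metis
  qed
  finally show ?thesis by simp
qed

text \<open>Deleting \<open>v\<close> crosses at most \<open>min N b - x v\<close> thresholds, while
  the drops \<open>N - x v\<close> add up to at most \<open>2 * N\<close>. This settles
  \<open>N \<le> b\<close> at once.\<close>

lemma sum_threshold_crossings:
  assumes fin: "finite S" and E: "\<And>e. e \<in> E \<Longrightarrow> card e = 2"
  shows "(\<Sum>v\<in>S. card {t \<in> {a..<b}. card (nonisolated E (S - {v})) \<le> t \<and> t < card (nonisolated E S)})
    \<le> 2 * b"
proof -
  define N where "N = card (nonisolated E S)"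
  define x where "x v = card (nonisolated E (S - {v}))" for v
  have xN: "x v \<le> N" for v
    unfolding x_def N_def using fin by (intro card_mono finite_nonisolated nonisolated_mono) auto
  have drop: "card (nonisolated E S - nonisolated E (S - {v})) = N - x v" for v
    unfolding x_def N_def using fin
    by (intro card_Diff_subset finite_nonisolated nonisolated_mono) auto
  have total: "(\<Sum>v\<in>S. N - x v) \<le> 2 * N"
    using sum_card_nonisolated_diff[of S E, OF fin E] unfolding drop N_def[symmetric] by simp
  have cross: "card {t \<in> {a..<b}. x v \<le> t \<and> t < N} \<le> min N b - x v" for v
  proof -
    have "{t \<in> {a..<b}. x v \<le> t \<and> t < N} \<subseteq> {x v..<min N b}" by auto
    from card_mono[OF _ this] show ?thesis by simp
  qed
  show ?thesis
  proof (cases "N \<le> b")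
    case True
    have "(\<Sum>v\<in>S. card {t \<in> {a..<b}. x v \<le> t \<and> t < N}) \<le> (\<Sum>v\<in>S. N - x v)"
      using cross True by (intro sum_mono) (metis min.absorb1)
    then show ?thesis using total True unfolding x_def N_def by linarith
  next
    case False
    \<comment> \<open>For \<open>b < N\<close> the truncated difference \<open>b - x v\<close> is at
      most the fraction \<open>b / N\<close> of the drop \<open>N - x v\<close>, which scales the
      total \<open>2 * N\<close> down to \<open>2 * b\<close>.\<close>
    have "N * (\<Sum>v\<in>S. card {t \<in> {a..<b}. x v \<le> t \<and> t < N}) \<le> b * (\<Sum>v\<in>S. N - x v)"
      unfolding sum_distrib_left
    proof (rule sum_mono)
      fix v
      have "N * card {t \<in> {a..<b}. x v \<le> t \<and> t < N} \<le> N * (b - x v)"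
        using cross[of v] False by (intro mult_left_mono) auto
      also have "\<dots> \<le> b * (N - x v)"
        using False by (auto simp: diff_mult_distrib2 mult.commute intro!: diff_le_mono2)
      finally show "N * card {t \<in> {a..<b}. x v \<le> t \<and> t < N} \<le> b * (N - x v)" .
    qed
    also have "\<dots> \<le> b * (2 * N)" using total by simp
    finally have "N * (\<Sum>v\<in>S. card {t \<in> {a..<b}. x v \<le> t \<and> t < N}) \<le> N * (2 * b)"
      by (simp add: mult_ac)
    then show ?thesis using False unfolding x_def N_def by simp
  qed
qed

text \<open>The only consequence of acyclicity that the counting argument needs.\<close>

definition good_set :: "'a set set \<Rightarrow> nat \<Rightarrow> 'a set \<Rightarrow> bool" where
  "good_set E l A \<longleftrightarrow> card (induced_edges E A) = l \<and> l < card (nonisolated E A)"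

text \<open>Every edge inside \<open>A\<close> already lies in the trace of \<open>A\<close> on the
  non-isolated vertices of \<open>S\<close>, so goodness can be tested on that trace.\<close>

lemma good_set_Int_nonisolated:
  assumes "A \<subseteq> S"
  shows "good_set E l (A \<inter> nonisolated E S) \<longleftrightarrow> good_set E l A"
  using induced_edges_Int_nonisolated[OF assms, of E] by (simp add: good_set_def nonisolated_def)

text \<open>
  The probability that a random \<open>j\<close>-subset spans at least \<open>l\<close> edges increases with \<open>j\<close> from \<open>0\<close> to at
  most \<open>1\<close>, and each good set contributes to the increase since deleting any of its \<open>l + 1\<close>
  non-isolated vertices leaves fewer than \<open>l\<close> edges.
\<close>

lemma good_set_LYM:
  assumes fin: "finite W"
  shows "(\<Sum>j<card W. slice_avg W (Suc j) (\<lambda>Q. of_bool (good_set E l Q)) / real (Suc j))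
    \<le> 1 / (real l + 1)"
proof -
  define F where "F j = slice_avg W j (\<lambda>Q. of_bool (l \<le> card (induced_edges E Q)))" for j
  have step: "(real l + 1) * (slice_avg W (Suc j) (\<lambda>Q. of_bool (good_set E l Q)) / real (Suc j))
      \<le> F (Suc j) - F j" if j: "j < card W" for j
  proof -
    have "F (Suc j) - F j = slice_avg W (Suc j) (\<lambda>Q. of_bool (l \<le> card (induced_edges E Q)) -
        (\<Sum>v\<in>Q. of_bool (l \<le> card (induced_edges E (Q - {v})))) / real (Suc j))"
      unfolding F_def slice_avg_shadow[OF fin j] slice_avg_diff ..
    also have "\<dots> \<ge> slice_avg W (Suc j) (\<lambda>Q. (real l + 1) / real (Suc j) * of_bool (good_set E l Q))"
    proof (rule slice_avg_mono)
      fix Q assume Q: "Q \<in> slice W (Suc j)"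
      have finQ: "finite Q" and cQ: "card Q = Suc j"
        using finite_in_slice[OF fin Q] Q by (auto simp: slice_def)
      have less: "card (induced_edges E (Q - {v})) \<le> card (induced_edges E Q)" for v
        using finQ by (intro card_mono finite_induced_edges induced_edges_mono) auto
      define T :: real where "T = (\<Sum>v\<in>Q. of_bool (l \<le> card (induced_edges E (Q - {v}))))"
      \<comment> \<open>A set that is not good only needs a nonnegative increment:
        \<open>Tle\<close> gives this if it spans at least \<open>l\<close> edges, and
        \<open>Tz\<close> if it spans fewer.\<close>
      have Tle: "T \<le> real (Suc j)"
        using sum_mono[of Q "\<lambda>v. of_bool (l \<le> card (induced_edges E (Q - {v})))" "\<lambda>_. 1::real"]
        by (simp add: T_def cQ)
      have Tz: "T = 0" if "card (induced_edges E Q) < l"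
        unfolding T_def by (rule sum.neutral) (use that less in \<open>auto simp: not_le intro: le_less_trans\<close>)
      have Tg: "T \<le> real (Suc j) - (real l + 1)" if g: "good_set E l Q"
      proof -
        have "T \<le> (\<Sum>v\<in>Q. of_bool (v \<notin> nonisolated E Q))"
          unfolding T_def
        proof (rule sum_mono)
          fix v assume "v \<in> Q"
          have "card (induced_edges E (Q - {v})) < l" if v: "v \<in> nonisolated E Q"
          proof -
            obtain e where "e \<in> induced_edges E Q" "v \<in> e" using v by (auto simp: nonisolated_def)
            then have "induced_edges E (Q - {v}) \<subset> induced_edges E Q"
              by (auto simp: induced_edges_def)
            then have "card (induced_edges E (Q - {v})) < card (induced_edges E Q)"
              using finQ by (intro psubset_card_mono finite_induced_edges)
            then show ?thesis using g by (simp add: good_set_def)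
          qed
          then show "of_bool (l \<le> card (induced_edges E (Q - {v}))) \<le> (of_bool (v \<notin> nonisolated E Q) :: real)"
            by (auto simp: not_le)
        qed
        also have "\<dots> = real (card (Q - nonisolated E Q))"
        proof -
          have "Q - nonisolated E Q = {v \<in> Q. v \<notin> nonisolated E Q}" by auto
          then show ?thesis using finQ by (simp add: of_bool_def sum.inter_filter[symmetric])
        qed
        also have "\<dots> = real (Suc j) - real (card (nonisolated E Q))"
          using card_Diff_subset[OF finite_nonisolated[OF finQ] nonisolated_subset, of E]
            card_mono[OF finQ nonisolated_subset, of E] by (simp add: cQ of_nat_diff)
        also have "\<dots> \<le> real (Suc j) - (real l + 1)" using g by (simp add: good_set_def)
        finally show ?thesis .
      qed
      show "(real l + 1) / real (Suc j) * of_bool (good_set E l Q) \<le>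
          of_bool (l \<le> card (induced_edges E Q)) -
          (\<Sum>v\<in>Q. of_bool (l \<le> card (induced_edges E (Q - {v})))) / real (Suc j)"
        unfolding T_def[symmetric]
      proof (cases "good_set E l Q")
        case True
        have "T / real (Suc j) \<le> (real (Suc j) - (real l + 1)) / real (Suc j)"
          using Tg[OF True] by (intro divide_right_mono) auto
        also have "\<dots> = 1 - (real l + 1) / real (Suc j)"
          by (simp add: diff_divide_distrib del: of_nat_Suc)
        finally show "(real l + 1) / real (Suc j) * of_bool (good_set E l Q) \<le>
            of_bool (l \<le> card (induced_edges E Q)) - T / real (Suc j)"
          using True by (simp add: good_set_def)
      next
        case False
        then show "(real l + 1) / real (Suc j) * of_bool (good_set E l Q) \<le>
            of_bool (l \<le> card (induced_edges E Q)) - T / real (Suc j)"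
          using Tz Tle by (cases "l \<le> card (induced_edges E Q)") (auto simp: field_simps)
      qed
    qed
    finally show ?thesis by (simp only: slice_avg_cmult) (simp add: field_simps)
  qed
  have "(real l + 1) * (\<Sum>j<card W. slice_avg W (Suc j) (\<lambda>Q. of_bool (good_set E l Q)) / real (Suc j))
      \<le> (\<Sum>j<card W. F (Suc j) - F j)"
    unfolding sum_distrib_left by (intro sum_mono step) simp
  also have "\<dots> = F (card W) - F 0" by (rule sum_lessThan_telescope)
  also have "\<dots> \<le> 1"
  proof -
    have "F 0 \<ge> 0" unfolding F_def by (rule slice_avg_nonneg) simp
    moreover have "F (card W) \<le> 1" unfolding F_def by (simp add: slice_avg_self fin)
    ultimately show ?thesis by linarith
  qed
  finally show ?thesis by (simp add: field_simps)
qed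

section \<open>Good subsets\<close>

text \<open>Squaring reduces the claim to the polynomial inequality \<open>key\<close>. There
  \<open>w \<le> 4 * l\<close> absorbs \<open>w * l\<close> into \<open>(l + 1) ^ 2\<close>, and
  \<open>w \<le> s / 4\<close> leaves an inequality in \<open>s\<close> alone, valid for
  \<open>s \<ge> 16\<close>.\<close>

lemma conditional_constant_bound:
  fixes k l s w :: real
  assumes l: "1 \<le> l" and k: "16 * l ^ 2 \<le> k" and s: "k \<le> s" and w: "1 \<le> w" "w \<le> 4 * l"
  shows "w * k / s * (2 * sqrt ((s + 1) ^ 3 / (k * (s + 1 - k) * w * (s + 1 - w)))) / (l + 1)
    \<le> 5 / sqrt l * sqrt (k / (s + 1 - k))"
proof (rule power2_le_imp_le)
  have "l \<le> l ^ 2" using l by (simp add: power2_eq_square)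
  then have s16: "16 * l \<le> s" "16 \<le> s" using k s l by linarith+
  have ws: "w \<le> s / 4" using s16 w by linarith
  have pos: "0 < s" "0 < k" "0 < s + 1 - k" "0 < w" "0 < s + 1 - w" "0 < l"
    using s16 k s w l ws \<open>l \<le> l ^ 2\<close> by linarith+
  have cubic: "16 * (s + 1) ^ 3 \<le> 25 * s ^ 2 * (s + 1 - w)"
  proof -
    have "16 * (s + 1) ^ 3 \<le> 25 * s ^ 2 * (3 / 4 * s + 1)"
    proof -
      \<comment> \<open>In powers of \<open>s - 16\<close> all coefficients of the difference are
        nonnegative.\<close>
      define y where "y = s - 16"
      have "0 \<le> y" "s = y + 16" using s16 by (auto simp: y_def)
      have "25 * s ^ 2 * (3 / 4 * s + 1) - 16 * (s + 1) ^ 3 =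
          11 / 4 * y ^ 3 + 109 * y ^ 2 + 1328 * y + 4592"
        unfolding \<open>s = y + 16\<close> by (simp add: power3_eq_cube power2_eq_square field_simps)
      moreover have "0 \<le> 11 / 4 * y ^ 3 + 109 * y ^ 2 + 1328 * y + 4592" using \<open>0 \<le> y\<close> by simp
      ultimately show ?thesis by linarith
    qed
    also have "\<dots> \<le> 25 * s ^ 2 * (s + 1 - w)" using ws by (intro mult_left_mono) auto
    finally show ?thesis .
  qed
  have key: "4 * w * l * (s + 1) ^ 3 \<le> 25 * s ^ 2 * (l + 1) ^ 2 * (s + 1 - w)"
  proof -
    have "4 * w * l * (s + 1) ^ 3 \<le> 4 * (4 * l) * l * (s + 1) ^ 3"
      using w pos by (intro mult_right_mono mult_left_mono) auto
    also have "\<dots> = l ^ 2 * (16 * (s + 1) ^ 3)" by (simp add: power2_eq_square)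
    also have "\<dots> \<le> (l + 1) ^ 2 * (25 * s ^ 2 * (s + 1 - w))"
      using pos by (intro mult_mono[OF power_mono cubic]) auto
    finally show ?thesis by (simp add: mult_ac)
  qed
  have "(w * k / s * (2 * sqrt ((s + 1) ^ 3 / (k * (s + 1 - k) * w * (s + 1 - w)))) / (l + 1)) ^ 2
      = (w * k / s * 2 / (l + 1)) ^ 2 * ((s + 1) ^ 3 / (k * (s + 1 - k) * w * (s + 1 - w)))"
    using pos by (simp add: power_mult_distrib power_divide mult_ac)
  also have "\<dots> = k / (s + 1 - k) * (4 * w * (s + 1) ^ 3 / (s ^ 2 * (l + 1) ^ 2 * (s + 1 - w)))"
    using pos by (simp add: power_mult_distrib power_divide power2_eq_square mult_ac)
  also have "\<dots> \<le> k / (s + 1 - k) * (25 / l)"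
  proof (rule mult_left_mono)
    have "l * (4 * w * (s + 1) ^ 3) \<le> 25 * (s ^ 2 * (l + 1) ^ 2 * (s + 1 - w))"
      using key by (simp add: mult_ac)
    moreover have "0 < s ^ 2 * (l + 1) ^ 2 * (s + 1 - w)" using pos by simp
    ultimately show "4 * w * (s + 1) ^ 3 / (s ^ 2 * (l + 1) ^ 2 * (s + 1 - w)) \<le> 25 / l"
      using pos by (simp add: frac_le_eq divide_le_eq le_divide_eq mult_ac)
  qed (use pos in simp)
  also have "\<dots> = (5 / sqrt l * sqrt (k / (s + 1 - k))) ^ 2"
    using pos by (simp add: power_mult_distrib power_divide)
  finally show "(w * k / s * (2 * sqrt ((s + 1) ^ 3 / (k * (s + 1 - k) * w * (s + 1 - w)))) / (l + 1)) ^ 2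
      \<le> (5 / sqrt l * sqrt (k / (s + 1 - k))) ^ 2" .
  show "0 \<le> 5 / sqrt l * sqrt (k / (s + 1 - k))" using pos by simp
qed

text \<open>Condition on the size of the trace of \<open>A\<close> on the non-isolated vertices of
  \<open>S\<close>. Absorption extracts the factor \<open>1 / Suc j\<close> from the hypergeometric
  weight; the rest is bounded uniformly in \<open>j\<close>, and \<open>good_set_LYM\<close> sums
  what remains.\<close>

lemma slice_avg_good_set_le:
  assumes fin: "finite S" and ks: "k \<le> card S" and l: "1 \<le> l" and k: "16 * l ^ 2 \<le> k"
    and N: "card (nonisolated E S) \<le> 4 * l"
  shows "slice_avg S k (\<lambda>A. of_bool (good_set E l A))
    \<le> 5 / sqrt (real l) * sqrt (real k / (real (card S) + 1 - real k))"
proof -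
  define W where "W = nonisolated E S"
  define w where "w = card W"
  define s where "s = card S"
  have WS: "W \<subseteq> S" and finW: "finite W"
    unfolding W_def by (rule nonisolated_subset, rule finite_nonisolated[OF fin])
  have "l \<le> l ^ 2" using l by (simp add: power2_eq_square)
  then have "4 * l \<le> k" using k by linarith
  then have wk: "w \<le> k" and ws: "w \<le> s" and kpos: "0 < k"
    using N ks l by (auto simp: w_def W_def s_def)
  define P where "P j = slice_avg W j (\<lambda>Q. of_bool (good_set E l Q))" for j
  have P0: "P 0 = 0"
  proof -
    have "slice W 0 = {{}}" using finite_subset[OF _ finW] by (auto simp: slice_def)
    then show ?thesis
      using nonisolated_subset[of E "{}"] by (simp add: P_def slice_avg_def good_set_def)
  qed
  have Pnn: "P j \<ge> 0" for j unfolding P_def by (rule slice_avg_nonneg) simp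
  have "(\<Sum>A\<in>slice S k. of_bool (good_set E l A)) = (\<Sum>A\<in>slice S k. of_bool (good_set E l (A \<inter> W)) :: real)"
    by (rule sum.cong[OF refl]) (simp add: W_def good_set_Int_nonisolated slice_def)
  also have "\<dots> = (\<Sum>j\<le>w. (\<Sum>Q\<in>slice W j. of_bool (good_set E l Q)) * real ((s - w) choose (k - j)))"
    unfolding w_def s_def using slice_sum_inter[OF fin WS] wk by (simp add: w_def)
  also have "\<dots> = (\<Sum>j\<le>w. P j * real (w choose j) * real ((s - w) choose (k - j)))"
    by (rule sum.cong[OF refl]) (simp add: P_def slice_avg_def w_def)
  also have "\<dots> = (\<Sum>j<w. P (Suc j) * real (w choose Suc j) * real ((s - w) choose (k - Suc j)))"
    unfolding lessThan_Suc_atMost[symmetric] sum.lessThan_Suc_shift by (simp add: P0)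
  finally have eq: "slice_avg S k (\<lambda>A. of_bool (good_set E l A)) =
      (\<Sum>j<w. P (Suc j) * real (w choose Suc j) * real ((s - w) choose (k - Suc j))) / real (s choose k)"
    by (simp add: slice_avg_def s_def)
  define M where "M = real w * real k / real s *
    (2 * sqrt ((real s + 1) ^ 3 / (real k * (real s + 1 - real k) * real w * (real s + 1 - real w))))"
  have term_le: "real (w choose Suc j) * real ((s - w) choose (k - Suc j)) / real (s choose k)
      \<le> M / real (Suc j)" if j: "j < w" for j
  proof -
    have abs1: "real (Suc j) * real (w choose Suc j) = real w * real ((w - 1) choose j)"
      using binomial_absorption[of j w] by (metis of_nat_mult)
    have abs2: "real k * real (s choose k) = real s * real ((s - 1) choose (k - 1))"
      using times_binomial_minus1_eq[OF kpos, of s] by (metis of_nat_mult)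
    have wpos: "0 < w" using j by simp
    have sum1: "(w - 1) + (s - w) = s - 1" using wpos ws by simp
    have "real (((w - 1) choose j) * ((s - w) choose ((k - 1) - j))) \<le>
        2 * sqrt ((real s + 1) ^ 3 / (real k * (real s + 1 - real k) * real w * (real s + 1 - real w)))
        * real ((s - 1) choose (k - 1))"
    proof -
      \<comment> \<open>Absorption lowers \<open>s\<close>, \<open>k\<close> and \<open>w\<close> by
        one, which cancels the shifts in \<open>hypergeometric_bound\<close>.\<close>
      have eqs: "real (s - 1) + 2 = real s + 1" "real (k - 1) + 1 = real k" "real (w - 1) + 1 = real w"
        using wpos kpos ws by (auto simp: of_nat_diff)
      have "k - 1 \<le> (w - 1) + (s - w)" "j \<le> k - 1" using j wk ks sum1 by (auto simp: s_def)
      from hypergeometric_bound[OF this] show ?thesis unfolding sum1 eqs .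
    qed
    then have "real w * (real ((w - 1) choose j) * real ((s - w) choose (k - Suc j)))
        \<le> real w * (2 * sqrt ((real s + 1) ^ 3 / (real k * (real s + 1 - real k) * real w * (real s + 1 - real w)))
          * real ((s - 1) choose (k - 1)))"
      by (intro mult_left_mono) auto
    also have "\<dots> = M * real (s choose k)"
    proof -
      have spos: "real s > 0" using ks kpos by (simp add: s_def)
      have "real ((s - 1) choose (k - 1)) = real k * real (s choose k) / real s"
        using abs2 spos by (simp add: field_simps)
      then show ?thesis by (simp add: M_def)
    qed
    finally have "real (Suc j) * (real (w choose Suc j) * real ((s - w) choose (k - Suc j))) \<le> M * real (s choose k)"
      using abs1 by (simp only: mult.assoc[symmetric])
    moreover have "real (s choose k) > 0" using ks by (simp add: s_def)
    ultimately show ?thesis by (simp add: divide_le_eq le_divide_eq mult_ac del: of_nat_Suc)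
  qed
  show ?thesis
  proof (cases "w = 0")
    case True
    then have "slice_avg S k (\<lambda>A. of_bool (good_set E l A)) = 0" using eq by simp
    then show ?thesis using ks by simp
  next
    case False
    have Mnn: "M \<ge> 0" unfolding M_def using ks ws by (auto simp: s_def)
    have "slice_avg S k (\<lambda>A. of_bool (good_set E l A)) =
        (\<Sum>j<w. P (Suc j) * (real (w choose Suc j) * real ((s - w) choose (k - Suc j)) / real (s choose k)))"
      unfolding eq by (simp add: sum_divide_distrib mult.assoc)
    also have "\<dots> \<le> (\<Sum>j<w. P (Suc j) * (M / real (Suc j)))"
      by (intro sum_mono mult_left_mono term_le Pnn) auto
    also have "\<dots> = M * (\<Sum>j<w. P (Suc j) / real (Suc j))"
      by (simp add: sum_distrib_left mult_ac)
    also have "\<dots> \<le> M * (1 / (real l + 1))"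
      unfolding P_def w_def using Mnn by (intro mult_left_mono good_set_LYM finW)
    also have "\<dots> = M / (real l + 1)" by simp
    also have "\<dots> \<le> 5 / sqrt (real l) * sqrt (real k / (real s + 1 - real k))"
      unfolding M_def
    proof (rule conditional_constant_bound)
      show "16 * (real l)\<^sup>2 \<le> real k" using k by (metis of_nat_le_iff of_nat_mult of_nat_numeral of_nat_power)
    qed (use l ks False N in \<open>auto simp: s_def w_def W_def\<close>)
    finally show ?thesis by (simp add: s_def)
  qed
qed

text \<open>Each summand is at most the increment of \<open>2 * sqrt\<close>, so the sum
  telescopes.\<close>

lemma sum_inverse_sqrt_le: "(\<Sum>i<n. 1 / sqrt (real (Suc i))) \<le> 2 * sqrt (real n)"
proof (induction n)
  case (Suc n)
  define a b where "a = sqrt (real n)" and "b = sqrt (real (Suc n))"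
  have ab: "a \<le> b" "0 < b" "0 \<le> a" "b ^ 2 = a ^ 2 + 1" by (auto simp: a_def b_def)
  have "1 = (b - a) * (b + a)" using ab by (simp add: power2_eq_square algebra_simps)
  also have "\<dots> \<le> (b - a) * (2 * b)" using ab by (intro mult_left_mono) auto
  finally have "1 / b \<le> 2 * b - 2 * a" using ab by (simp add: field_simps)
  then show ?case using Suc.IH by (simp add: a_def b_def)
qed simp

text \<open>
  For a threshold \<open>t\<close>, let \<open>u t s\<close> average, over \<open>s\<close>-subsets \<open>S\<close> with at most \<open>t\<close> non-isolated
  vertices, the fraction of good \<open>k\<close>-subsets of \<open>S\<close>. The difference \<open>u t s - u t (s + 1)\<close> only sees
  pairs \<open>(S, v)\<close> at which deleting \<open>v\<close> crosses the threshold; averaging over \<open>2l \<le> t < 4l\<close> makes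
  their proportion at most \<open>4 / (s + 1)\<close>.
\<close>

lemma slice_avg_good_set_bound:
  assumes fin: "finite V" and E: "\<And>e. e \<in> E \<Longrightarrow> card e = 2"
    and kV: "2 * k \<le> card V" and l: "1 \<le> l" and k: "16 * l ^ 2 \<le> k"
  shows "slice_avg V k (\<lambda>A. of_bool (good_set E l A)) \<le> 45 / sqrt (real l)"
proof -
  define p where "p = slice_avg V k (\<lambda>A. of_bool (good_set E l A))"
  define g where "g S = slice_avg S k (\<lambda>A. of_bool (good_set E l A))" for S
  define N where "N S = card (nonisolated E S)" for S
  define u where "u t s = slice_avg V s (\<lambda>S. of_bool (N S \<le> t) * g S)" for t s
  define B where "B s = 5 / sqrt (real l) * sqrt (real k / (real s + 1 - real k))" for s
  have kpos: "0 < k" using k l by (auto intro: gr0I)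
  have gB: "g S \<le> B s" if "S \<in> slice V s" "k \<le> s" "N S \<le> 4 * l" for S s
    using slice_avg_good_set_le[OF finite_in_slice[OF fin that(1)], of k l E] that l k
    by (simp add: g_def B_def N_def slice_def)
  have gnn: "0 \<le> g S" for S unfolding g_def by (rule slice_avg_nonneg) simp
  have Bnn: "0 \<le> B s" if "k \<le> s" for s using that by (simp add: B_def)
  \<comment> \<open>A good set has \<open>l\<close> edges, hence at most \<open>2 * l\<close>
    non-isolated vertices, so no threshold \<open>t \<ge> 2 * l\<close> excludes it.\<close>
  have start: "u t k = p" if t: "2 * l \<le> t" for t
    unfolding u_def p_def
  proof (rule slice_avg_cong)
    fix A assume A: "A \<in> slice V k"
    have finA: "finite A" using finite_in_slice[OF fin A] .
    have "g A = of_bool (good_set E l A)"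
      using slice_avg_self[OF finA] A by (simp add: g_def slice_def)
    moreover have "N A \<le> t" if "good_set E l A"
      using card_nonisolated_le[of E A, OF E] that t by (simp add: N_def good_set_def)
    ultimately show "of_bool (N A \<le> t) * g A = of_bool (good_set E l A)" by auto
  qed
  have finish: "u t (2 * k) \<le> B (2 * k)" if t: "t < 4 * l" for t
  proof -
    have "u t (2 * k) \<le> slice_avg V (2 * k) (\<lambda>_. B (2 * k))"
      unfolding u_def
    proof (rule slice_avg_mono)
      fix S assume "S \<in> slice V (2 * k)"
      then show "of_bool (N S \<le> t) * g S \<le> B (2 * k)" using gB[of S "2 * k"] Bnn[of "2 * k"] t by auto
    qed
    then show ?thesis by (simp add: slice_avg_const[OF fin kV])
  qed
  have step: "u t s - u t (Suc s) \<le> slice_avg V (Suc s) (\<lambda>S. B s / real (Suc s) *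
      (\<Sum>v\<in>S. of_bool (N (S - {v}) \<le> t \<and> t < N S)))"
    if s: "k \<le> s" "s < 2 * k" and t: "t < 4 * l" for s t
  proof -
    have sV: "s < card V" using s kV by simp
    have "u t s - u t (Suc s) = slice_avg V (Suc s) (\<lambda>S.
        (\<Sum>v\<in>S. of_bool (N (S - {v}) \<le> t) * g (S - {v})) / real (Suc s) - of_bool (N S \<le> t) * g S)"
      unfolding u_def slice_avg_shadow[OF fin sV] slice_avg_diff ..
    also have "\<dots> \<le> slice_avg V (Suc s) (\<lambda>S. B s / real (Suc s) *
        (\<Sum>v\<in>S. of_bool (N (S - {v}) \<le> t \<and> t < N S)))"
    proof (rule slice_avg_mono)
      fix S assume S: "S \<in> slice V (Suc s)"
      have finS: "finite S" and cS: "card S = Suc s" and SV: "S \<subseteq> V"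
        using finite_in_slice[OF fin S] S by (auto simp: slice_def)
      \<comment> \<open>Writing \<open>g S\<close> as the average of \<open>g (S - {v})\<close> lets
        the two indicators cancel except where deleting \<open>v\<close> crosses the
        threshold.\<close>
      have gS: "g S = (\<Sum>v\<in>S. g (S - {v})) / real (Suc s)"
        unfolding g_def using slice_avg_remove[OF finS, of k] s cS by simp
      have "(\<Sum>v\<in>S. of_bool (N (S - {v}) \<le> t) * g (S - {v})) / real (Suc s) - of_bool (N S \<le> t) * g S
          = (\<Sum>v\<in>S. (of_bool (N (S - {v}) \<le> t) - of_bool (N S \<le> t)) * g (S - {v})) / real (Suc s)"
        unfolding gS by (simp add: sum_distrib_left sum_subtractf left_diff_distrib diff_divide_distrib del: of_nat_Suc)
      also have "\<dots> \<le> (\<Sum>v\<in>S. of_bool (N (S - {v}) \<le> t \<and> t < N S) * B s) / real (Suc s)"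
      proof (intro divide_right_mono sum_mono)
        fix v assume v: "v \<in> S"
        have mono: "N (S - {v}) \<le> N S"
          unfolding N_def using finS by (intro card_mono finite_nonisolated nonisolated_mono) auto
        have "S - {v} \<in> slice V s" using finS cS SV v by (auto simp: slice_def)
        then have "N (S - {v}) \<le> t \<Longrightarrow> g (S - {v}) \<le> B s" using gB s t by auto
        then show "(of_bool (N (S - {v}) \<le> t) - of_bool (N S \<le> t)) * g (S - {v})
            \<le> of_bool (N (S - {v}) \<le> t \<and> t < N S) * B s"
          using mono by auto
      qed simp
      also have "\<dots> = B s / real (Suc s) * (\<Sum>v\<in>S. of_bool (N (S - {v}) \<le> t \<and> t < N S))"
        by (simp add: sum_distrib_left sum_divide_distrib mult_ac del: of_nat_Suc)
      finally show "(\<Sum>v\<in>S. of_bool (N (S - {v}) \<le> t) * g (S - {v})) / real (Suc s) - of_bool (N S \<le> t) * g S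
          \<le> B s / real (Suc s) * (\<Sum>v\<in>S. of_bool (N (S - {v}) \<le> t \<and> t < N S))" .
    qed
    finally show ?thesis .
  qed
  \<comment> \<open>The factor \<open>8 * l\<close> is the crossing bound \<open>2 * b\<close> at
    \<open>b = 4 * l\<close>; spread over \<open>2 * l\<close> thresholds it leaves
    \<open>4\<close>.\<close>
  have crossings: "(\<Sum>t\<in>{2*l..<4*l}. u t s - u t (Suc s)) \<le> 8 * real l * (B s / real (Suc s))"
    if s: "k \<le> s" "s < 2 * k" for s
  proof -
    have "(\<Sum>t\<in>{2*l..<4*l}. u t s - u t (Suc s)) \<le> (\<Sum>t\<in>{2*l..<4*l}. slice_avg V (Suc s)
        (\<lambda>S. B s / real (Suc s) * (\<Sum>v\<in>S. of_bool (N (S - {v}) \<le> t \<and> t < N S))))"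
      by (intro sum_mono step s) auto
    also have "\<dots> = slice_avg V (Suc s) (\<lambda>S. \<Sum>t\<in>{2*l..<4*l}. B s / real (Suc s) *
        (\<Sum>v\<in>S. of_bool (N (S - {v}) \<le> t \<and> t < N S)))"
      by (rule slice_avg_sum[symmetric])
    also have "\<dots> \<le> slice_avg V (Suc s) (\<lambda>_. B s / real (Suc s) * (8 * real l))"
    proof (rule slice_avg_mono)
      fix S assume S: "S \<in> slice V (Suc s)"
      have finS: "finite S" using finite_in_slice[OF fin S] .
      have "(\<Sum>t\<in>{2*l..<4*l}. \<Sum>v\<in>S. of_bool (N (S - {v}) \<le> t \<and> t < N S) :: real) =
          (\<Sum>v\<in>S. \<Sum>t\<in>{2*l..<4*l}. of_bool (N (S - {v}) \<le> t \<and> t < N S))"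
        by (rule sum.swap)
      also have "\<dots> = (\<Sum>v\<in>S. real (card {t \<in> {2*l..<4*l}. N (S - {v}) \<le> t \<and> t < N S}))"
        unfolding of_bool_def by (simp only: sum.inter_filter[symmetric] finite_atLeastLessThan) simp
      also have "\<dots> \<le> real (2 * (4 * l))"
        unfolding of_nat_sum[symmetric] of_nat_le_iff N_def
        by (rule sum_threshold_crossings[OF finS E])
      finally have "(\<Sum>t\<in>{2*l..<4*l}. \<Sum>v\<in>S. of_bool (N (S - {v}) \<le> t \<and> t < N S)) \<le> 8 * real l"
        by simp
      then show "(\<Sum>t\<in>{2*l..<4*l}. B s / real (Suc s) * (\<Sum>v\<in>S. of_bool (N (S - {v}) \<le> t \<and> t < N S)))
          \<le> B s / real (Suc s) * (8 * real l)"
        unfolding sum_distrib_left[symmetric] using Bnn[OF s(1)] by (intro mult_left_mono) auto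
    qed
    also have "\<dots> = 8 * real l * (B s / real (Suc s))"
      using slice_avg_const[OF fin, of "Suc s"] s kV by simp
    finally show ?thesis .
  qed
  have B2k: "B (2 * k) \<le> 5 / sqrt (real l)"
  proof -
    have "sqrt (real k / (real (2 * k) + 1 - real k)) \<le> 1" by simp
    from mult_left_mono[OF this, of "5 / sqrt (real l)"] show ?thesis by (simp add: B_def)
  qed
  have Bsum: "(\<Sum>s\<in>{k..<2*k}. B s / real (Suc s)) \<le> 10 / sqrt (real l)"
  proof -
    have "(\<Sum>s\<in>{k..<2*k}. B s / real (Suc s)) = (\<Sum>i<k. B (i + k) / real (Suc (i + k)))"
      using sum.shift_bounds_nat_ivl[of "\<lambda>s. B s / real (Suc s)" 0 k k]
      by (simp add: mult_2 atLeast0LessThan)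
    also have "\<dots> \<le> (\<Sum>i<k. 5 / sqrt (real l) / sqrt (real k) * (1 / sqrt (real (Suc i))))"
    proof (rule sum_mono)
      fix i
      have "sqrt (real k) / real (Suc (i + k)) \<le> sqrt (real k) / real k"
        using kpos by (intro divide_left_mono) auto
      also have "\<dots> = 1 / sqrt (real k)" using kpos by (simp add: field_simps)
      finally have "5 / sqrt (real l) / sqrt (real (Suc i)) * (sqrt (real k) / real (Suc (i + k)))
          \<le> 5 / sqrt (real l) / sqrt (real (Suc i)) * (1 / sqrt (real k))"
        by (intro mult_left_mono) auto
      then show "B (i + k) / real (Suc (i + k)) \<le> 5 / sqrt (real l) / sqrt (real k) * (1 / sqrt (real (Suc i)))"
        by (simp add: B_def real_sqrt_divide add.commute mult_ac)
    qed
    also have "\<dots> \<le> 5 / sqrt (real l) / sqrt (real k) * (2 * sqrt (real k))"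
      unfolding sum_distrib_left[symmetric] by (intro mult_left_mono sum_inverse_sqrt_le) auto
    also have "\<dots> = 10 / sqrt (real l)" using kpos by simp
    finally show ?thesis .
  qed
  have tele: "p = u t (2 * k) + (\<Sum>s\<in>{k..<2*k}. u t s - u t (Suc s))" if "2 * l \<le> t" for t
    using sum_Suc_diff'[of k "2 * k" "\<lambda>s. - u t s"] start[OF that] by simp
  have "2 * real l * p = (\<Sum>t\<in>{2*l..<4*l}. p)" by (simp add: of_nat_diff)
  also have "\<dots> = (\<Sum>t\<in>{2*l..<4*l}. u t (2 * k)) + (\<Sum>s\<in>{k..<2*k}. \<Sum>t\<in>{2*l..<4*l}. u t s - u t (Suc s))"
    by (subst sum.swap, subst sum.distrib[symmetric], rule sum.cong[OF refl], rule tele) simp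
  also have "\<dots> \<le> (\<Sum>t\<in>{2*l..<4*l}. 5 / sqrt (real l)) + (\<Sum>s\<in>{k..<2*k}. 8 * real l * (B s / real (Suc s)))"
    using B2k by (intro add_mono sum_mono crossings order.trans[OF finish]) auto
  also have "\<dots> = 2 * real l * (5 / sqrt (real l)) + 8 * real l * (\<Sum>s\<in>{k..<2*k}. B s / real (Suc s))"
    by (simp add: of_nat_diff sum_distrib_left)
  also have "\<dots> \<le> 2 * real l * (5 / sqrt (real l)) + 8 * real l * (10 / sqrt (real l))"
    using Bsum by (intro add_left_mono mult_left_mono) auto
  \<comment> \<open>The constant is \<open>5 + 4 * 10\<close>: \<open>5\<close> from reaching
    \<open>2 * k\<close>, and \<open>4\<close> times the sum \<open>Bsum\<close> from stopping
    earlier.\<close>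
  also have "\<dots> = 2 * real l * (45 / sqrt (real l))" by simp
  finally have "2 * real l * p \<le> 2 * real l * (45 / sqrt (real l))" .
  then show ?thesis unfolding p_def[symmetric]
    by (rule mult_left_le_imp_le) (use l in simp)
qed

section \<open>Binomial coefficients with n < 2k\<close>

text \<open>The added term \<open>k * (k - 1) / (2 * n)\<close> is the sum of the
  \<open>i / n\<close>. The induction rests on \<open>(1 - x) * (1 + T + x) \<le> 1 + T\<close> for
  nonnegative \<open>x\<close> and \<open>T\<close>.\<close>

lemma prod_one_minus_le:
  assumes "k \<le> n"
  shows "(\<Prod>i<k. 1 - real i / real n) * (1 + real k * (real k - 1) / (2 * real n)) \<le> 1"
  using assms
proof (induction k)
  case (Suc k)
  define x T where "x = real k / real n" and "T = real k * (real k - 1) / (2 * real n)"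
  have n: "0 < real n" using Suc.prems by simp
  have x: "0 \<le> x" "x \<le> 1" using Suc.prems by (auto simp: x_def)
  have T: "0 \<le> T" unfolding T_def by (cases k) auto
  have eq: "real (Suc k) * (real (Suc k) - 1) / (2 * real n) = T + x"
    using n by (simp add: x_def T_def field_simps)
  have "(1 - x) * (1 + (T + x)) \<le> 1 + T" using x T by (simp add: algebra_simps)
  moreover have "0 \<le> (\<Prod>i<k. 1 - real i / real n)"
    using Suc.prems by (intro prod_nonneg) auto
  ultimately have "(\<Prod>i<k. 1 - real i / real n) * ((1 - x) * (1 + (T + x)))
      \<le> (\<Prod>i<k. 1 - real i / real n) * (1 + T)" by (rule mult_left_mono)
  also have "\<dots> \<le> 1" using Suc by (simp add: T_def)
  finally show ?case unfolding eq by (simp add: x_def mult.assoc)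
qed simp

lemma binomial_eq_prod_one_minus:
  assumes "0 < n"
  shows "real (n choose k) = (\<Prod>i<k. 1 - real i / real n) * (real n ^ k / fact k)"
proof -
  have "real (n choose k) = (\<Prod>i<k. real n - real i) / fact k"
    by (simp add: binomial_gbinomial gbinomial_prod_rev atLeast0LessThan)
  also have "(\<Prod>i<k. real n - real i) = (\<Prod>i<k. (1 - real i / real n) * real n)"
    using assms by (intro prod.cong) (auto simp: field_simps)
  also have "\<dots> = (\<Prod>i<k. 1 - real i / real n) * real n ^ k" by (simp add: prod.distrib)
  finally show ?thesis by simp
qed

lemma binomial_le_of_less_double:
  assumes "0 < k" "k \<le> n" "n < 2 * k"
  shows "real (n choose k) \<le> 4 / real k * (real n ^ k / fact k)"
proof -
  define p where "p = (\<Prod>i<k. 1 - real i / real n)"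
  have p0: "0 \<le> p" unfolding p_def using assms by (intro prod_nonneg) auto
  \<comment> \<open>Here \<open>n < 2 * k\<close> enters: the quadratic term is at least
    \<open>(k - 1) / 4\<close>.\<close>
  have "real k / 4 \<le> 1 + real k * (real k - 1) / (2 * real n)"
  proof -
    have "(real k - 1) / 4 = real k * (real k - 1) / (4 * real k)" using assms by simp
    also have "\<dots> \<le> real k * (real k - 1) / (2 * real n)"
      using assms by (intro divide_left_mono mult_nonneg_nonneg) auto
    finally show ?thesis by simp
  qed
  from mult_left_mono[OF this p0] have "p * (real k / 4) \<le> 1"
    using prod_one_minus_le[OF assms(2)] by (simp add: p_def)
  then have "p \<le> 4 / real k" using assms(1) by (simp add: field_simps)
  then have "p * (real n ^ k / fact k) \<le> 4 / real k * (real n ^ k / fact k)"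
    by (intro mult_right_mono) auto
  then show ?thesis using binomial_eq_prod_one_minus[of n k] assms by (simp add: p_def)
qed

lemma binomial_le_pow_div_fact: "real (n choose k) \<le> real n ^ k / fact k"
proof -
  have "real ((n choose k) * fact k) \<le> real (n ^ k)"
    using binomial_fact_pow of_nat_le_iff by blast
  then show ?thesis by (simp add: field_simps)
qed

section \<open>From induced forests to good sets\<close>

lemma forest_good_set:
  assumes E: "\<And>e. e \<in> edges G \<Longrightarrow> card e = 2" and fin: "finite A" and l: "1 \<le> l"
    and F: "forest (induced_subgraph G A)" and c: "card (edges (induced_subgraph G A)) = l"
  shows "good_set (edges G) l A"
proof -
  let ?F = "induced_edges (edges G) A"
  have edges_eq: "edges (induced_subgraph G A) = ?F"
    by (simp add: induced_subgraph_def induced_edges_def)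
  have "card ?F < card (\<Union>?F)"
  proof (rule acyclic_card_edges)
    show "finite ?F" using fin by (rule finite_induced_edges)
    show "?F \<noteq> {}" using c l edges_eq by auto
    show "\<nexists>c. length c \<ge> 3 \<and> distinct c \<and> (\<forall>i<length c. {c ! i, c ! (Suc i mod length c)} \<in> ?F)"
    proof
      assume "\<exists>c. length c \<ge> 3 \<and> distinct c \<and> (\<forall>i<length c. {c ! i, c ! (Suc i mod length c)} \<in> ?F)"
      then obtain c where c: "length c \<ge> 3" "distinct c"
        "\<forall>i<length c. {c ! i, c ! (Suc i mod length c)} \<in> ?F" by blast
      have "set c \<subseteq> A" using c(3) by (auto simp: in_set_conv_nth induced_edges_def)
      then have "is_cycle (induced_subgraph G A) c"
        using c by (simp add: is_cycle_def edges_eq) (simp add: induced_subgraph_def)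
      then show False using F by (auto simp: forest_def)
    qed
  qed (use E in \<open>auto simp: induced_edges_def\<close>)
  then show ?thesis using c edges_eq by (simp add: good_set_def nonisolated_def)
qed

theorem theorem1p6:
  fixes G :: "'a ugraph" and k l n :: nat
  assumes "simple_graph G"
    and "card (verts G) = n"
    and "n \<ge> k"
    and "k \<ge> 1"
    and "1 \<le> l"
    and "real l \<le> sqrt (real k) / 4"
  shows "real (card {A. A \<subseteq> verts G \<and> card A = k \<and>
            forest (induced_subgraph G A) \<and> card (edges (induced_subgraph G A)) = l})
         \<le> 50 * real l powr (-1/2) * (real n ^ k / fact k)"
proof -
  define V E where "V = verts G" and "E = edges G"
  define X where "X = {A. A \<subseteq> verts G \<and> card A = k \<and>
    forest (induced_subgraph G A) \<and> card (edges (induced_subgraph G A)) = l}"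
  define R where "R = real n ^ k / fact k"
  have fin: "finite V" and E2: "\<And>e. e \<in> E \<Longrightarrow> card e = 2" and cV: "card V = n"
    using assms(1,2) by (auto simp: simple_graph_def V_def E_def)
  have R: "R \<ge> 0" by (simp add: R_def)
  have kl: "16 * l ^ 2 \<le> k"
  proof -
    have "(4 * real l) ^ 2 \<le> sqrt (real k) ^ 2" using assms(6) by (intro power_mono) auto
    then have "real (16 * l ^ 2) \<le> real k" by (simp add: power_mult_distrib)
    then show ?thesis by (simp only: of_nat_le_iff)
  qed
  have "real (card X) \<le> 45 / sqrt (real l) * R"
  \<comment> \<open>The averaging argument runs through subsets of size up to \<open>2 * k\<close>,
    so it needs that many vertices.\<close>
  proof (cases "2 * k \<le> n")
    case True
    define Y where "Y = {A \<in> slice V k. good_set E l A}"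
    have "X \<subseteq> Y"
    proof
      fix A assume A: "A \<in> X"
      then have "A \<in> slice V k" by (simp add: X_def V_def slice_def)
      moreover have "good_set E l A"
        unfolding E_def by (rule forest_good_set)
          (use A E2 assms(5) finite_in_slice[OF fin calculation] in \<open>auto simp: X_def E_def\<close>)
      ultimately show "A \<in> Y" by (simp add: Y_def)
    qed
    then have "real (card X) \<le> real (card Y)"
      using fin by (simp add: card_mono Y_def)
    also have "\<dots> = slice_avg V k (\<lambda>A. of_bool (good_set E l A)) * real (n choose k)"
      using fin assms(3) by (simp add: slice_avg_def cV Y_def of_bool_def sum.inter_filter[symmetric])
    also have "\<dots> \<le> 45 / sqrt (real l) * R"
      unfolding R_def using True fin E2 assms(5) kl cV
      by (intro mult_mono slice_avg_good_set_bound binomial_le_pow_div_fact) auto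
    finally show ?thesis .
  next
    case False
    have "X \<subseteq> slice V k" by (auto simp: X_def V_def slice_def)
    then have "real (card X) \<le> real (n choose k)"
      using card_mono[of "slice V k" X] fin by (simp add: card_slice cV)
    also have "\<dots> \<le> 4 / real k * R"
      unfolding R_def using assms False by (intro binomial_le_of_less_double) auto
    also have "\<dots> \<le> 45 / sqrt (real l) * R"
    proof (rule mult_right_mono[OF _ R])
      have "l \<le> l ^ 2" using assms(5) by (simp add: power2_eq_square)
      then have "l \<le> k" using kl by linarith
      moreover have "sqrt (real l) \<le> real l"
        using assms(5) by (intro real_le_lsqrt) (auto simp: power2_eq_square)
      ultimately have "sqrt (real l) \<le> real k" by linarith
      then show "4 / real k \<le> 45 / sqrt (real l)" using assms(5) by (intro frac_le) auto
    qed
    finally show ?thesis .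
  qed
  also have "\<dots> \<le> 50 * real l powr (-1/2) * R"
  proof (rule mult_right_mono[OF _ R])
    have "real l powr (-1/2) = 1 / sqrt (real l)"
      using assms(5) by (simp add: powr_minus_divide powr_half_sqrt)
    then show "45 / sqrt (real l) \<le> 50 * real l powr (-1/2)"
      by (simp add: divide_right_mono)
  qed
  finally show ?thesis unfolding X_def R_def .
qed

end
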